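(* Let $\mathbb{T}$ be a time scale, let $a,b\in\mathbb{T}$ with $a<b$, let $f,g:[a,b]_{\mathbb{T}}\to\mathbb{R}_{\mathcal{I}}$ be $ID$ $\Delta$-integrable on $[a,b]_{\mathbb{T}}$, and let $\lambda$ be an arbitrary real number. Then: (1) $\lambda f$ is $ID$ $\Delta$-integrable on $[a,b]_{\mathbb{T}}$ and $(ID)\int_a^b\lambda f(t)\Delta t=\lambda\,(ID)\int_a^b f(t)\Delta t$; (2) $f+g$ is $ID$ $\Delta$-integrable on $[a,b]_{\mathbb{T}}$ and $(ID)\int_a^b (f(t)+g(t))\Delta t\subseteq (ID)\int_a^b f(t)\Delta t+(ID)\int_a^b g(t)\Delta t$; (3) for $c\in[a,b]_{\mathbb{T}}$ with $a<c<b$, $(ID)\int_a^c f(t)\Delta t+(ID)\int_c^b f(t)\Delta t=(ID)\int_a^b f(t)\Delta t$; (4) if $f(t)\subseteq g(t)$ for all $t\in[a,b]_{\mathbb{T}}$, then $(ID)\int_a^b f(t)\Delta t\subseteq(ID)\int_a^b g(t)\Delta t$.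
   Context: A time scale $\mathbb{T}$ is a nonempty closed subset of $\mathbb{R}$. For $a,b\in\mathbb{T}$, $[a,b]_{\mathbb{T}}=\{t\in\mathbb{T}:a\le t\le b\}$ and $[a,b)_{\mathbb{T}}=\{t\in\mathbb{T}:a\le t<b\}$. $\mathbb{R}_{\mathcal{I}}$ is the set of nonempty compact intervals $[\underline{u},\overline{u}]\subset\mathbb{R}$, $\underline{u}\le\overline{u}$ (degenerate intervals allowed). Interval operations: $[\underline{u},\overline{u}]+[\underline{v},\overline{v}]=[\underline{u}+\underline{v},\overline{u}+\overline{v}]$; $\lambda[\underline{u},\overline{u}]$ equals $[\lambda\underline{u},\lambda\overline{u}]$ if $\lambda>0$, $\{0\}$ if $\lambda=0$, $[\lambda\overline{u},\lambda\underline{u}]$ if $\lambda<0$. Operations on interval-valued functions are pointwise. A division of $[a,b]_{\mathbb{T}}$ is a finite set $D=\{a=t_0<t_1<\cdots<t_n=b\}\subseteq[a,b]_{\mathbb{T}}$. For $f=[\underline{f},\overline{f}]$ put $m_i=\inf\{\underline{f}(t):t\in[t_{i-1},t_i)_{\mathbb{T}}\}$, $M_i=\sup\{\overline{f}(t):t\in[t_{i-1},t_i)_{\mathbb{T}}\}$, $L(\underline{f},D)=\sum_{i=1}^n m_i(t_i-t_{i-1})$, $U(\overline{f},D)=\sum_{i=1}^n M_i(t_i-t_{i-1})$. The lower Darboux $\Delta$-integral of $\underline{f}$ is $\sup_D L(\underline{f},D)$ and the upper Darboux $\Delta$-integral of $\overline{f}$ is $\inf_D U(\overline{f},D)$, over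 all divisions $D$ of $[a,b]_{\mathbb{T}}$. The function $f$ is $ID$ $\Delta$-integrable on $[a,b]_{\mathbb{T}}$ if these two numbers are finite, and then $$(ID)\int_a^b f(t)\Delta t=\Big[\sup_D L(\underline{f},D),\ \inf_D U(\overline{f},D)\Big].$$ *)

theory Defs
  imports Complex_Main "HOL-Library.Extended_Real" "HOL-Library.Interval"
begin

definition time_scale :: "real set \<Rightarrow> bool" where
  "time_scale T \<longleftrightarrow> T \<noteq> {} \<and> closed T"

definition ts_Icc :: "real set \<Rightarrow> real \<Rightarrow> real \<Rightarrow> real set" where
  "ts_Icc T a b = {t \<in> T. a \<le> t \<and> t \<le> b}"

definition ts_Ico :: "real set \<Rightarrow> real \<Rightarrow> real \<Rightarrow> real set" where
  "ts_Ico T a b = {t \<in> T. a \<le> t \<and> t < b}"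

text \<open>Nonempty compact real intervals are the elements of \<^typ>\<open>real interval\<close>, whose library
  addition is endpointwise. The library provides no multiplication by a scalar.\<close>

definition scale_interval :: "real \<Rightarrow> real interval \<Rightarrow> real interval" where
  "scale_interval c X =
     (if c > 0 then Interval (c * lower X, c * upper X)
      else if c = 0 then interval_of 0
      else Interval (c * upper X, c * lower X))"

definition divisions :: "real set \<Rightarrow> real \<Rightarrow> real \<Rightarrow> real set set" where
  "divisions T a b = {D. finite D \<and> D \<subseteq> ts_Icc T a b \<and> a \<in> D \<and> b \<in> D}"

text \<open>The points of a division \<open>D\<close> in increasing order are \<open>node D 0 < ... < node D n\<close> with
  \<open>n = card D - 1\<close>.\<close>

definition node :: "real set \<Rightarrow> nat \<Rightarrow> real" where
  "node D i = sorted_list_of_set D ! i"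

text \<open>Infima, suprema and Darboux sums are formed in \<^typ>\<open>ereal\<close> because the endpoint functions
  need not be bounded. Each \<open>ts_Ico T (node D (i - 1)) (node D i)\<close> contains \<open>node D (i - 1)\<close>, so in
  a lower sum the infima are never \<open>\<infinity>\<close> and in an upper sum the suprema are never \<open>- \<infinity>\<close>;
  hence no sum mixes the two infinities.\<close>

definition lower_sum :: "real set \<Rightarrow> (real \<Rightarrow> real) \<Rightarrow> real set \<Rightarrow> ereal" where
  "lower_sum T h D =
     (\<Sum>i = 1..card D - 1. (INF t \<in> ts_Ico T (node D (i - 1)) (node D i). ereal (h t))
                           * ereal (node D i - node D (i - 1)))"

definition upper_sum :: "real set \<Rightarrow> (real \<Rightarrow> real) \<Rightarrow> real set \<Rightarrow> ereal" where
  "upper_sum T h D =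
     (\<Sum>i = 1..card D - 1. (SUP t \<in> ts_Ico T (node D (i - 1)) (node D i). ereal (h t))
                           * ereal (node D i - node D (i - 1)))"

definition lower_darboux :: "real set \<Rightarrow> real \<Rightarrow> real \<Rightarrow> (real \<Rightarrow> real) \<Rightarrow> ereal" where
  "lower_darboux T a b h = (SUP D \<in> divisions T a b. lower_sum T h D)"

definition upper_darboux :: "real set \<Rightarrow> real \<Rightarrow> real \<Rightarrow> (real \<Rightarrow> real) \<Rightarrow> ereal" where
  "upper_darboux T a b h = (INF D \<in> divisions T a b. upper_sum T h D)"

text \<open>Only the values of \<open>f\<close> on \<open>ts_Icc T a b\<close> enter the following two definitions.\<close>

definition ID_integrable :: "real set \<Rightarrow> real \<Rightarrow> real \<Rightarrow> (real \<Rightarrow> real interval) \<Rightarrow> bool" where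
  "ID_integrable T a b f \<longleftrightarrow>
     \<bar>lower_darboux T a b (\<lambda>t. lower (f t))\<bar> \<noteq> \<infinity> \<and>
     \<bar>upper_darboux T a b (\<lambda>t. upper (f t))\<bar> \<noteq> \<infinity>"

text \<open>The value is meaningful only for integrable \<open>f\<close>, for which the two Darboux integrals are real
  and correctly ordered.\<close>

definition ID_integral :: "real set \<Rightarrow> real \<Rightarrow> real \<Rightarrow> (real \<Rightarrow> real interval) \<Rightarrow> real interval" where
  "ID_integral T a b f =
     Interval (real_of_ereal (lower_darboux T a b (\<lambda>t. lower (f t))),
               real_of_ereal (upper_darboux T a b (\<lambda>t. upper (f t))))"

end

theory Submission
  imports Defs
begin

text \<open>
  All four claims reduce to facts about the real-valued lower Darboux integral. Since negation
  exchanges infima and suprema, the upper integral of \<open>h\<close> is the negative of the lower integral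
  of \<open>- h\<close> (\<open>upper_darboux_conv_lower\<close>), so that every statement about lower integrals has a mirror
  image for upper ones. This is also what makes a negative scalar exchange the two endpoints.

  The driving fact is that a lower sum can only grow when the division is refined. On one cell
  the map \<open>(x, y) \<mapsto> inf h * (y - x)\<close> is superadditive under subdivision
  (\<open>lower_cell_superadditive\<close>), and \<open>division_sum_refine\<close> passes this on to whole divisions.
  Passing to the union of two divisions then gives superadditivity of the lower integral, which is
  the inclusion for \<open>f + g\<close>, and the inequality between lower and upper integrals. Inserting the
  point \<open>c\<close> into a division gives additivity over \<open>[a, c]\<close> and \<open>[c, b]\<close>. Monotonicity in the
  integrand is visible on each cell.

  Finiteness is where the interval setting needs an argument. The lower integral of the sum of
  the lower endpoints is bounded below by superadditivity, but no bound from above comes from the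
  lower endpoints alone: lower integrals of sums are not subadditive. The bound comes from the upper
  endpoints, because \<open>lower (f t + g t) \<le> upper (f t + g t)\<close> and the upper integral is subadditive
  (\<open>ID_integral_add_subset\<close>).

  The endpoint functions may be unbounded, so all sums are extended real numbers and \<open>\<infinity> + - \<infinity>\<close>
  has to be kept away. This works because a lower sum is never \<open>\<infinity>\<close> (\<open>lower_sum_less_top\<close>): each
  half-open cell contains its left end.
\<close>

section \<open>Sums over the cells of a division\<close>

text \<open>A division of \<open>[a, b]\<close> arises from \<open>{a}\<close> by repeatedly appending a new largest point. This
  turns claims about sums over indexed nodes into inductions in which the last cell splits off
  (see \<open>division_sum_snoc\<close>), without any reference to the enumeration.\<close>

lemma divisions_induct [consumes 1, case_names singleton snoc]:
  assumes "D \<in> divisions T a b"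
    and singleton: "P a {a}"
    and snoc: "\<And>c b D. D \<in> divisions T a c \<Longrightarrow> c < b \<Longrightarrow> b \<in> T \<Longrightarrow> P c D \<Longrightarrow> P b (insert b D)"
  shows "P b D"
  using assms(1)
proof (induction "card D" arbitrary: D b rule: less_induct)
  case less
  note D = less.prems[unfolded divisions_def ts_Icc_def]
  show ?case
  proof (cases "a = b")
    case True
    with D have "D = {a}" by auto
    with True singleton show ?thesis by simp
  next
    case False
    define D' where "D' = D - {b}"
    define c where "c = Max D'"
    have fin: "finite D'" and ne: "D' \<noteq> {}" and aD': "a \<in> D'"
      using D False by (auto simp: D'_def)
    have c: "c \<in> D'" using fin ne by (simp add: c_def)
    then have cb: "c < b" using D by (auto simp: D'_def less_le)
    have D': "D' \<in> divisions T a c"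
      using D fin c aD' by (auto simp: divisions_def ts_Icc_def D'_def c_def)
    have "card D' < card D"
      using D unfolding D'_def by (intro card_Diff1_less) auto
    then have "P c D'" using less.hyps D' by blast
    then have "P b (insert b D')" using snoc[OF D' cb] D by auto
    then show ?thesis using D by (simp add: D'_def insert_absorb)
  qed
qed

text \<open>Lower and upper sums are the two instances of interest; allowing an arbitrary function of
  the cell separates the combinatorics of divisions from infima and suprema.\<close>

definition division_sum :: "(real \<Rightarrow> real \<Rightarrow> ereal) \<Rightarrow> real set \<Rightarrow> ereal" where
  "division_sum \<phi> D = (\<Sum>i = 1..card D - 1. \<phi> (node D (i - 1)) (node D i))"

lemma division_sum_singleton [simp]: "division_sum \<phi> {x} = 0"
  by (simp add: division_sum_def)

lemma division_sum_snoc: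
  assumes "D \<in> divisions T a c" "c < b"
  shows "division_sum \<phi> (insert b D) = division_sum \<phi> D + \<phi> c b"
proof -
  have D: "finite D" "c \<in> D" "\<And>x. x \<in> D \<Longrightarrow> x \<le> c"
    using assms by (auto simp: divisions_def ts_Icc_def)
  have bD: "b \<notin> D" using D(3) assms(2) by force
  define xs where "xs = sorted_list_of_set D"
  have xs: "set xs = D" "sorted xs" "length xs = card D" using D by (simp_all add: xs_def)
  obtain n where n: "card D = Suc n" using D by (metis card_gt_0_iff empty_iff gr0_conv_Suc)
  have "sorted_list_of_set (insert b D) = insort b xs"
    using D bD by (simp add: xs_def)
  also have "\<dots> = xs @ [b]"
    using D(3) assms(2) xs by (intro sorted_insort_is_snoc) force+
  finally have nd: "node (insert b D) i = (if i < card D then node D i else b)" if "i \<le> card D" for i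
    using that xs(3) by (auto simp: node_def xs_def nth_append)
  have "xs ! n = c"
  proof (rule antisym)
    show "xs ! n \<le> c" using D(3) xs n by (metis lessI nth_mem)
    obtain j where "j < length xs" "xs ! j = c" using D(2) xs(1) by (metis in_set_conv_nth)
    then show "c \<le> xs ! n" using sorted_nth_mono[OF xs(2), of j n] xs(3) n by auto
  qed
  then have c: "node D n = c" by (simp add: node_def xs_def)
  have "(\<Sum>i = 1..n. \<phi> (node (insert b D) (i - 1)) (node (insert b D) i)) = 
     (\<Sum>i = 1..n. \<phi> (node D (i - 1)) (node D i))"
    using n by (intro sum.cong) (auto simp: nd)
  then show ?thesis
    using D bD n c by (simp add: division_sum_def nd)
qed

lemma division_sum_split:
  assumes "D \<in> divisions T a b" "c \<in> D"
  shows "division_sum \<phi> D = division_sum \<phi> (D \<inter> {..c}) + division_sum \<phi> (D \<inter> {c..})"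
  using assms
proof (induction rule: divisions_induct)
  case singleton
  then show ?case by simp
next
  case (snoc x y D)
  have D: "\<And>z. z \<in> D \<Longrightarrow> z \<le> x" "finite D" "x \<in> D" "D \<subseteq> T"
    using snoc.hyps(1) by (auto simp: divisions_def ts_Icc_def)
  show ?case
  proof (cases "c = y")
    case True
    have "insert y D \<inter> {..y} = insert y D" "insert y D \<inter> {y..} = {y}"
      using D snoc.hyps(2) by force+
    with True show ?thesis by (simp only: division_sum_singleton add_0_right)
  next
    case False
    then have c: "c \<in> D" "c \<le> x" using snoc.prems D by auto
    have div: "D \<inter> {c..} \<in> divisions T c x"
      using D c by (auto simp: divisions_def ts_Icc_def)
    have "insert y D \<inter> {..c} = D \<inter> {..c}" "insert y D \<inter> {c..} = insert y (D \<inter> {c..})"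
      using c snoc.hyps(2) by auto
    then show ?thesis
      using snoc.IH[OF c(1)] division_sum_snoc[OF snoc.hyps(1,2), of \<phi>]
        division_sum_snoc[OF div snoc.hyps(2), of \<phi>] by (simp add: add.assoc)
  qed
qed

lemma division_restrict:
  assumes "D \<in> divisions T a b" "c \<in> D"
  shows "D \<inter> {..c} \<in> divisions T a c" "D \<inter> {c..} \<in> divisions T c b"
  using assms by (auto simp: divisions_def ts_Icc_def)

lemma division_sum_join:
  assumes "D \<in> divisions T a c" "E \<in> divisions T c b"
  shows "D \<union> E \<in> divisions T a b"
    and "division_sum \<phi> (D \<union> E) = division_sum \<phi> D + division_sum \<phi> E"
proof -
  show DE: "D \<union> E \<in> divisions T a b"
    using assms by (fastforce simp: divisions_def ts_Icc_def)
  have "(D \<union> E) \<inter> {..c} = D" "(D \<union> E) \<inter> {c..} = E" "c \<in> D \<union> E"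
    using assms by (fastforce simp: divisions_def ts_Icc_def)+
  then show "division_sum \<phi> (D \<union> E) = division_sum \<phi> D + division_sum \<phi> E"
    using division_sum_split[OF DE, of c \<phi>] by simp
qed

text \<open>For a superadditive \<open>\<phi>\<close> the trivial division \<open>{a, b}\<close> has the least sum. Applied to each
  cell of a division, this yields monotonicity under refinement.\<close>

lemma division_sum_coarsest:
  assumes "D \<in> divisions T a b" "a < b"
    and super: "\<And>x y z. x < y \<Longrightarrow> y < z \<Longrightarrow> \<phi> x z \<le> \<phi> x y + \<phi> y z"
  shows "\<phi> a b \<le> division_sum \<phi> D"
  using assms(1,2)
proof (induction rule: divisions_induct)
  case singleton
  then show ?case by simp
next
  case (snoc c b D)
  note step = division_sum_snoc[OF snoc.hyps(1,2), of \<phi>]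
  show ?case
  proof (cases "a = c")
    case True
    then have "D = {a}" using snoc.hyps(1) by (auto simp: divisions_def ts_Icc_def)
    with True step show ?thesis by simp
  next
    case False
    then have ac: "a < c" using snoc.hyps(1) by (auto simp: divisions_def ts_Icc_def)
    have "\<phi> a b \<le> \<phi> a c + \<phi> c b" using super[OF ac snoc.hyps(2)] .
    also have "\<dots> \<le> division_sum \<phi> D + \<phi> c b" using snoc.IH[OF ac] by (rule add_right_mono)
    finally show ?thesis using step by simp
  qed
qed

text \<open>Cutting the finer division at the penultimate point of the coarser one leaves a
  refinement of the shorter division, covered by induction, and a division of a single cell,
  covered by \<open>division_sum_coarsest\<close>.\<close>

lemma division_sum_refine:
  assumes "D \<in> divisions T a b" "E \<in> divisions T a b" "D \<subseteq> E"
    and super: "\<And>x y z. x < y \<Longrightarrow> y < z \<Longrightarrow> \<phi> x z \<le> \<phi> x y + \<phi> y z"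
  shows "division_sum \<phi> D \<le> division_sum \<phi> E"
  using assms(1-3)
proof (induction arbitrary: E rule: divisions_induct)
  case singleton
  then have "E = {a}" by (auto simp: divisions_def ts_Icc_def)
  then show ?case by simp
next
  case (snoc c b D)
  have c: "c \<in> E" using snoc.hyps(1) snoc.prems(2) by (auto simp: divisions_def)
  have "D \<subseteq> E \<inter> {..c}" using snoc.hyps(1) snoc.prems(2) by (auto simp: divisions_def ts_Icc_def)
  then have "division_sum \<phi> D \<le> division_sum \<phi> (E \<inter> {..c})"
    by (rule snoc.IH[OF division_restrict(1)[OF snoc.prems(1) c]])
  moreover have "\<phi> c b \<le> division_sum \<phi> (E \<inter> {c..})"
    using division_restrict(2)[OF snoc.prems(1) c] snoc.hyps(2) super by (rule division_sum_coarsest)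
  ultimately show ?case
    unfolding division_sum_snoc[OF snoc.hyps(1,2)] division_sum_split[OF snoc.prems(1) c]
    by (rule add_mono)
qed

lemma division_sum_mono:
  assumes "D \<in> divisions T a b"
    and "\<And>x y. x \<in> T \<Longrightarrow> y \<in> T \<Longrightarrow> a \<le> x \<Longrightarrow> x < y \<Longrightarrow> y \<le> b \<Longrightarrow> \<phi> x y \<le> \<psi> x y"
  shows "division_sum \<phi> D \<le> division_sum \<psi> D"
  using assms
proof (induction rule: divisions_induct)
  case singleton
  then show ?case by simp
next
  case (snoc c b D)
  have "c \<in> T" "a \<le> c" using snoc.hyps(1) by (auto simp: divisions_def ts_Icc_def)
  then show ?case using snoc by (auto simp: division_sum_snoc intro!: add_mono)
qed

lemma division_sum_add:
  "division_sum (\<lambda>x y. \<phi> x y + \<psi> x y) D = division_sum \<phi> D + division_sum \<psi> D"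
  by (simp add: division_sum_def sum.distrib)

section \<open>Lower and upper sums\<close>

definition lower_cell :: "real set \<Rightarrow> (real \<Rightarrow> real) \<Rightarrow> real \<Rightarrow> real \<Rightarrow> ereal" where
  "lower_cell T h x y = (INF t \<in> ts_Ico T x y. ereal (h t)) * ereal (y - x)"

definition upper_cell :: "real set \<Rightarrow> (real \<Rightarrow> real) \<Rightarrow> real \<Rightarrow> real \<Rightarrow> ereal" where
  "upper_cell T h x y = (SUP t \<in> ts_Ico T x y. ereal (h t)) * ereal (y - x)"

lemma lower_sum_eq: "lower_sum T h = division_sum (lower_cell T h)"
  by (rule ext) (simp add: lower_sum_def division_sum_def lower_cell_def)

lemma upper_sum_eq: "upper_sum T h = division_sum (upper_cell T h)"
  by (rule ext) (simp add: upper_sum_def division_sum_def upper_cell_def)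

lemma INF_ts_Ico_less_top:
  assumes "x \<in> T" "x < y"
  shows "(INF t \<in> ts_Ico T x y. ereal (h t)) < \<infinity>"
proof -
  have "(INF t \<in> ts_Ico T x y. ereal (h t)) \<le> ereal (h x)"
    using assms by (intro INF_lower) (auto simp: ts_Ico_def)
  then show ?thesis by auto
qed

lemma lower_cell_less_top:
  assumes "x \<in> T" "x < y"
  shows "lower_cell T h x y < \<infinity>"
  using INF_ts_Ico_less_top[OF assms, of h] assms(2)
  by (cases "INF t \<in> ts_Ico T x y. ereal (h t)") (auto simp: lower_cell_def)

text \<open>Shrinking the cell enlarges the infimum, while the length is additive.\<close>

lemma lower_cell_superadditive:
  assumes "x < y" "y < z"
  shows "lower_cell T h x z \<le> lower_cell T h x y + lower_cell T h y z"
proof -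
  let ?m = "INF t \<in> ts_Ico T x z. ereal (h t)"
  have "lower_cell T h x z = ?m * (ereal (y - x) + ereal (z - y))"
    by (simp add: lower_cell_def)
  also have "\<dots> = ?m * ereal (y - x) + ?m * ereal (z - y)"
    using assms by (intro ereal_right_distrib) auto
  also have "\<dots> \<le> lower_cell T h x y + lower_cell T h y z"
    unfolding lower_cell_def using assms
    by (intro add_mono ereal_mult_right_mono INF_superset_mono) (auto simp: ts_Ico_def)
  finally show ?thesis .
qed

lemma lower_sum_less_top:
  assumes "D \<in> divisions T a b"
  shows "lower_sum T h D < \<infinity>"
  using assms
proof (induction rule: divisions_induct)
  case singleton
  then show ?case by (simp add: lower_sum_eq)
next
  case (snoc c b D)
  have "c \<in> T" using snoc.hyps(1) by (auto simp: divisions_def ts_Icc_def)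
  then show ?case
    using snoc lower_cell_less_top[of c T b h] by (simp add: lower_sum_eq division_sum_snoc)
qed

lemma lower_sum_refine:
  assumes "D \<in> divisions T a b" "E \<in> divisions T a b" "D \<subseteq> E"
  shows "lower_sum T h D \<le> lower_sum T h E"
  unfolding lower_sum_eq using assms by (rule division_sum_refine) (rule lower_cell_superadditive)

lemma lower_sum_mono:
  assumes "D \<in> divisions T a b" "\<And>t. t \<in> ts_Icc T a b \<Longrightarrow> h t \<le> k t"
  shows "lower_sum T h D \<le> lower_sum T k D"
  unfolding lower_sum_eq using assms(1)
proof (rule division_sum_mono)
  fix x y assume "a \<le> x" "x < y" "y \<le> b"
  then show "lower_cell T h x y \<le> lower_cell T k x y"
    unfolding lower_cell_def
    by (intro ereal_mult_right_mono INF_superset_mono) (auto simp: ts_Icc_def ts_Ico_def assms(2))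
qed

lemma lower_sum_add:
  assumes "D \<in> divisions T a b"
  shows "lower_sum T h D + lower_sum T k D \<le> lower_sum T (\<lambda>t. h t + k t) D"
  unfolding lower_sum_eq division_sum_add[symmetric] using assms
proof (rule division_sum_mono)
  fix x y assume xy: "x \<in> T" "x < y"
  let ?I = "\<lambda>h. INF t \<in> ts_Ico T x y. ereal (h t)"
  have top: "?I h < \<infinity>" "?I k < \<infinity>"
    using xy by (rule INF_ts_Ico_less_top)+
  have "lower_cell T h x y + lower_cell T k x y = (?I h + ?I k) * ereal (y - x)"
    unfolding lower_cell_def using top by (intro ereal_distrib[symmetric]) auto
  also have "\<dots> \<le> lower_cell T (\<lambda>t. h t + k t) x y"
    unfolding lower_cell_def plus_ereal.simps(1)[symmetric] using xy
    by (intro ereal_mult_right_mono INF_greatest add_mono INF_lower) auto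
  finally show "lower_cell T h x y + lower_cell T k x y \<le> lower_cell T (\<lambda>t. h t + k t) x y" .
qed

text \<open>Negation distributes over the sum only because the lower terms are never \<open>\<infinity>\<close>, so that
  opposite infinities do not meet.\<close>

lemma lower_sum_uminus:
  assumes "D \<in> divisions T a b"
  shows "lower_sum T (\<lambda>t. - h t) D = - upper_sum T h D"
  using assms
proof (induction rule: divisions_induct)
  case singleton
  then show ?case by (simp add: lower_sum_eq upper_sum_eq)
next
  case (snoc c b D)
  have cell: "lower_cell T (\<lambda>t. - h t) c b = - upper_cell T h c b"
    by (simp add: lower_cell_def upper_cell_def ereal_INF_uminus_eq flip: uminus_ereal.simps)
  have "c \<in> T" using snoc.hyps(1) by (auto simp: divisions_def ts_Icc_def)
  then have "lower_cell T (\<lambda>t. - h t) c b < \<infinity>" "lower_sum T (\<lambda>t. - h t) D < \<infinity>"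
    using snoc lower_cell_less_top lower_sum_less_top by blast+
  then show ?case
    using snoc.IH cell unfolding lower_sum_eq upper_sum_eq division_sum_snoc[OF snoc.hyps(1,2)]
    by (cases "upper_cell T h c b"; cases "division_sum (upper_cell T h) D") auto
qed

lemma lower_sum_le_upper_sum:
  assumes "D \<in> divisions T a b" "\<And>t. h t \<le> k t"
  shows "lower_sum T h D \<le> upper_sum T k D"
  unfolding lower_sum_eq upper_sum_eq using assms(1)
proof (rule division_sum_mono)
  fix x y assume "x \<in> T" "x < y"
  then have "x \<in> ts_Ico T x y" by (auto simp: ts_Ico_def)
  then have "(INF t \<in> ts_Ico T x y. ereal (h t)) \<le> (SUP t \<in> ts_Ico T x y. ereal (k t))"
    using INF_lower[of x _ "\<lambda>t. ereal (h t)"] SUP_upper[of x _ "\<lambda>t. ereal (k t)"] assms(2)[of x]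
    by (meson ereal_less_eq(3) order_trans)
  then show "lower_cell T h x y \<le> upper_cell T k x y"
    using \<open>x < y\<close> by (simp add: lower_cell_def upper_cell_def ereal_mult_right_mono)
qed

section \<open>Lower and upper Darboux integrals\<close>

lemma upper_darboux_conv_lower: "upper_darboux T a b h = - lower_darboux T a b (\<lambda>t. - h t)"
proof -
  have "lower_darboux T a b (\<lambda>t. - h t) = (SUP D \<in> divisions T a b. - upper_sum T h D)"
    unfolding lower_darboux_def by (intro SUP_cong refl lower_sum_uminus)
  then show ?thesis by (simp add: upper_darboux_def ereal_SUP_uminus_eq)
qed

lemma divisions_union:
  "D \<in> divisions T a b \<Longrightarrow> E \<in> divisions T a b \<Longrightarrow> D \<union> E \<in> divisions T a b"
  by (auto simp: divisions_def)

lemma divisions_nonempty: "a \<in> T \<Longrightarrow> b \<in> T \<Longrightarrow> a \<le> b \<Longrightarrow> divisions T a b \<noteq> {}"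
  by (auto simp: divisions_def ts_Icc_def intro!: exI[of _ "{a, b}"])

text \<open>Two divisions are compared through their union: refining raises lower sums and lowers
  upper sums.\<close>

lemma lower_darboux_le_upper_darboux:
  assumes "\<And>t. h t \<le> k t"
  shows "lower_darboux T a b h \<le> upper_darboux T a b k"
  unfolding lower_darboux_def upper_darboux_def
proof (intro SUP_least INF_greatest)
  fix D E assume D: "D \<in> divisions T a b" and E: "E \<in> divisions T a b"
  note DE = divisions_union[OF D E]
  have "lower_sum T h D \<le> lower_sum T h (D \<union> E)" using D DE by (rule lower_sum_refine) auto
  also have "\<dots> \<le> upper_sum T k (D \<union> E)" using DE assms by (rule lower_sum_le_upper_sum)
  also have "\<dots> \<le> upper_sum T k E"
    using lower_sum_refine[OF E DE, of "\<lambda>t. - k t"] lower_sum_uminus[OF E, of k]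
      lower_sum_uminus[OF DE, of k] by simp
  finally show "lower_sum T h D \<le> upper_sum T k E" .
qed

lemma SUP_neq_minus_inftyE:
  fixes F :: "_ \<Rightarrow> ereal"
  assumes "(SUP x \<in> A. F x) \<noteq> - \<infinity>"
  obtains x where "x \<in> A" "F x \<noteq> - \<infinity>"
  using assms SUP_bot_conv(1)[of F A] by (auto simp: bot_ereal_def)

text \<open>This lets two suprema be bounded by treating their members separately, as needed when each
  summand comes with its own division. If one of the suprema is \<open>- \<infinity>\<close> and the other \<open>\<infinity>\<close>, then
  their sum in the extended reals is \<open>\<infinity>\<close> even if all sums of members are \<open>- \<infinity>\<close>.\<close>

lemma SUP_add_SUP_le:
  fixes F G :: "_ \<Rightarrow> ereal"
  assumes F: "(SUP x \<in> A. F x) \<noteq> - \<infinity>" and G: "(SUP y \<in> B. G y) \<noteq> - \<infinity>"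
    and le: "\<And>x y. x \<in> A \<Longrightarrow> y \<in> B \<Longrightarrow> F x + G y \<le> C"
  shows "(SUP x \<in> A. F x) + (SUP y \<in> B. G y) \<le> C"
proof -
  have ne: "A \<noteq> {}" "B \<noteq> {}" using F G by (auto simp: bot_ereal_def)
  have *: "F x + (SUP y \<in> B. G y) \<le> C" if "x \<in> A" "F x \<noteq> - \<infinity>" for x
    using that le ne by (subst SUP_ereal_add_right[symmetric]) (auto intro!: SUP_least)
  show ?thesis
  proof (cases "(SUP y \<in> B. G y) = \<infinity>")
    case True
    obtain x where "x \<in> A" "F x \<noteq> - \<infinity>"
      using F by (rule SUP_neq_minus_inftyE)
    then have "C = \<infinity>" using *[of x] True by auto
    then show ?thesis by simp
  next
    case False
    have "F x + (SUP y \<in> B. G y) \<le> C" if "x \<in> A" for x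
      using *[OF that] False by (cases "F x = - \<infinity>"; cases "SUP y \<in> B. G y") auto
    then show ?thesis
      using G ne by (subst SUP_ereal_add_left[symmetric]) (auto intro!: SUP_least)
  qed
qed

lemma lower_darboux_superadditive:
  assumes "lower_darboux T a b h \<noteq> - \<infinity>" "lower_darboux T a b k \<noteq> - \<infinity>"
  shows "lower_darboux T a b h + lower_darboux T a b k \<le> lower_darboux T a b (\<lambda>t. h t + k t)"
  using assms unfolding lower_darboux_def[of T a b h] lower_darboux_def[of T a b k]
proof (rule SUP_add_SUP_le)
  fix D E assume D: "D \<in> divisions T a b" and E: "E \<in> divisions T a b"
  note DE = divisions_union[OF D E]
  have "lower_sum T h D + lower_sum T k E \<le> lower_sum T h (D \<union> E) + lower_sum T k (D \<union> E)"
    using D E DE by (intro add_mono lower_sum_refine) auto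
  also have "\<dots> \<le> lower_sum T (\<lambda>t. h t + k t) (D \<union> E)" using DE by (rule lower_sum_add)
  also have "\<dots> \<le> lower_darboux T a b (\<lambda>t. h t + k t)"
    unfolding lower_darboux_def using DE by (rule SUP_upper)
  finally show "lower_sum T h D + lower_sum T k E \<le> lower_darboux T a b (\<lambda>t. h t + k t)" .
qed

lemma lower_darboux_mono:
  assumes "\<And>t. t \<in> ts_Icc T a b \<Longrightarrow> h t \<le> k t"
  shows "lower_darboux T a b h \<le> lower_darboux T a b k"
  unfolding lower_darboux_def using assms by (intro SUP_subset_mono lower_sum_mono) auto

lemma upper_darboux_mono:
  assumes "\<And>t. t \<in> ts_Icc T a b \<Longrightarrow> h t \<le> k t"
  shows "upper_darboux T a b h \<le> upper_darboux T a b k"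
  using assms by (auto simp: upper_darboux_conv_lower intro!: lower_darboux_mono)

lemma upper_darboux_subadditive:
  assumes "upper_darboux T a b h \<noteq> \<infinity>" "upper_darboux T a b k \<noteq> \<infinity>"
  shows "upper_darboux T a b (\<lambda>t. h t + k t) \<le> upper_darboux T a b h + upper_darboux T a b k"
proof -
  let ?h = "lower_darboux T a b (\<lambda>t. - h t)" and ?k = "lower_darboux T a b (\<lambda>t. - k t)"
  have "?h + ?k \<le> lower_darboux T a b (\<lambda>t. - (h t + k t))"
    using lower_darboux_superadditive[of T a b "\<lambda>t. - h t" "\<lambda>t. - k t"] assms
    by (simp add: upper_darboux_conv_lower ereal_uminus_eq_reorder)
  moreover have "- (?h + ?k) = - ?h + - ?k"
    using assms by (cases ?h; cases ?k) (auto simp: upper_darboux_conv_lower)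
  ultimately show ?thesis
    by (metis ereal_minus_le_minus upper_darboux_conv_lower)
qed

text \<open>A division of \<open>[a, b]\<close> can be assumed to contain \<open>c\<close>, because adding that point only raises
  the lower sum, and divisions containing \<open>c\<close> are the unions of divisions of the two parts.
  Finiteness on the parts is not clear in advance, as one part could be \<open>\<infinity>\<close> and the other
  \<open>- \<infinity>\<close>. It holds because some lower sum on \<open>[a, b]\<close> exceeds \<open>- \<infinity>\<close>, and then so do both of
  its parts.\<close>

lemma lower_darboux_split:
  assumes c: "c \<in> ts_Icc T a b" and fin: "\<bar>lower_darboux T a b h\<bar> \<noteq> \<infinity>"
  shows "\<bar>lower_darboux T a c h\<bar> \<noteq> \<infinity>" "\<bar>lower_darboux T c b h\<bar> \<noteq> \<infinity>"
    and "lower_darboux T a c h + lower_darboux T c b h = lower_darboux T a b h"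
proof -
  let ?L = "lower_darboux T a c h" and ?R = "lower_darboux T c b h"
  have split: "\<exists>E\<in>divisions T a c. \<exists>F\<in>divisions T c b. lower_sum T h D \<le> lower_sum T h E + lower_sum T h F"
    if D: "D \<in> divisions T a b" for D
  proof -
    have D': "insert c D \<in> divisions T a b" using D c by (auto simp: divisions_def)
    have "lower_sum T h D \<le> lower_sum T h (insert c D)" using D D' by (rule lower_sum_refine) auto
    also have "\<dots> = lower_sum T h (insert c D \<inter> {..c}) + lower_sum T h (insert c D \<inter> {c..})"
      unfolding lower_sum_eq using D' by (rule division_sum_split) simp
    finally show ?thesis using division_restrict[OF D', of c] by blast
  qed
  have upper: "lower_sum T h E \<le> lower_darboux T x y h" if "E \<in> divisions T x y" for E x y
    unfolding lower_darboux_def using that by (rule SUP_upper)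
  have le: "lower_darboux T a b h \<le> ?L + ?R"
    unfolding lower_darboux_def[of T a b]
  proof (rule SUP_least)
    fix D assume "D \<in> divisions T a b"
    from split[OF this] show "lower_sum T h D \<le> ?L + ?R"
      using upper by (meson add_mono order_trans)
  qed
  have "(SUP D \<in> divisions T a b. lower_sum T h D) \<noteq> - \<infinity>"
    using fin unfolding lower_darboux_def by auto
  then obtain D where "D \<in> divisions T a b" "lower_sum T h D \<noteq> - \<infinity>"
    by (rule SUP_neq_minus_inftyE)
  then obtain E F where EF: "E \<in> divisions T a c" "F \<in> divisions T c b"
    and "lower_sum T h E + lower_sum T h F \<noteq> - \<infinity>"
    using split by fastforce
  (* As neither part is \<infinity>, a part equal to - \<infinity> would make the total - \<infinity>. *)
  then have "lower_sum T h E \<noteq> - \<infinity>" "lower_sum T h F \<noteq> - \<infinity>"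
    using lower_sum_less_top[OF EF(1), of h] lower_sum_less_top[OF EF(2), of h] by auto
  then have bot: "?L \<noteq> - \<infinity>" "?R \<noteq> - \<infinity>"
    using upper[OF EF(1)] upper[OF EF(2)] by auto
  have ge: "?L + ?R \<le> lower_darboux T a b h"
    using bot unfolding lower_darboux_def[of T a c] lower_darboux_def[of T c b]
  proof (rule SUP_add_SUP_le)
    fix E F assume "E \<in> divisions T a c" "F \<in> divisions T c b"
    note EF = division_sum_join[OF this]
    show "lower_sum T h E + lower_sum T h F \<le> lower_darboux T a b h"
      using upper[OF EF(1)] EF(2)[of "lower_cell T h"] by (simp add: lower_sum_eq)
  qed
  show "?L + ?R = lower_darboux T a b h" using le ge by simp
  then show "\<bar>?L\<bar> \<noteq> \<infinity>" "\<bar>?R\<bar> \<noteq> \<infinity>" using bot fin by auto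
qed

lemma upper_darboux_split:
  assumes "c \<in> ts_Icc T a b" and "\<bar>upper_darboux T a b h\<bar> \<noteq> \<infinity>"
  shows "\<bar>upper_darboux T a c h\<bar> \<noteq> \<infinity>" "\<bar>upper_darboux T c b h\<bar> \<noteq> \<infinity>"
    and "upper_darboux T a c h + upper_darboux T c b h = upper_darboux T a b h"
proof -
  note split = lower_darboux_split[OF assms(1), of "\<lambda>t. - h t"]
  have fin: "\<bar>lower_darboux T a b (\<lambda>t. - h t)\<bar> \<noteq> \<infinity>"
    using assms(2) by (simp add: upper_darboux_conv_lower)
  show "\<bar>upper_darboux T a c h\<bar> \<noteq> \<infinity>" "\<bar>upper_darboux T c b h\<bar> \<noteq> \<infinity>"
    using split(1,2)[OF fin] by (simp_all add: upper_darboux_conv_lower)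
  show "upper_darboux T a c h + upper_darboux T c b h = upper_darboux T a b h"
    using split[OF fin] unfolding upper_darboux_conv_lower
    by (cases "lower_darboux T a c (\<lambda>t. - h t)"; cases "lower_darboux T c b (\<lambda>t. - h t)"; 
        cases "lower_darboux T a b (\<lambda>t. - h t)") auto
qed

text \<open>The scalar \<open>0\<close> fits in with the positive ones because every cell contains its left end:
  over an empty set the infimum would stay \<open>\<infinity>\<close> instead of becoming \<open>0\<close>.\<close>

lemma lower_sum_scale:
  assumes "D \<in> divisions T a b" "0 \<le> r"
  shows "lower_sum T (\<lambda>t. r * h t) D = ereal r * lower_sum T h D"
  using assms(1)
proof (induction rule: divisions_induct)
  case singleton
  then show ?case by (simp add: lower_sum_eq)
next
  case (snoc c b D)
  have "c \<in> T" using snoc.hyps(1) by (auto simp: divisions_def ts_Icc_def)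
  then have ne: "ts_Ico T c b \<noteq> {}" using snoc.hyps(2) by (auto simp: ts_Ico_def)
  have "(INF t \<in> ts_Ico T c b. ereal (r * h t)) = - (SUP t \<in> ts_Ico T c b. ereal r * - ereal (h t))"
    by (simp flip: ereal_INF_uminus_eq)
  also have "\<dots> = ereal r * (INF t \<in> ts_Ico T c b. ereal (h t))"
    unfolding Sup_ereal_mult_left'[OF ne assms(2), symmetric] ereal_SUP_uminus_eq by simp
  finally have "lower_cell T (\<lambda>t. r * h t) c b = ereal r * lower_cell T h c b"
    by (simp add: lower_cell_def mult.assoc)
  moreover have "ereal r * (x + y) = ereal r * x + ereal r * y" for x y
    using distrib_left_ereal_nn[OF assms(2)] by (simp add: mult.commute)
  ultimately show ?case
    using snoc by (simp add: lower_sum_eq division_sum_snoc)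
qed

lemma lower_darboux_scale:
  assumes "a \<in> T" "b \<in> T" "a \<le> b" "0 \<le> r"
  shows "lower_darboux T a b (\<lambda>t. r * h t) = ereal r * lower_darboux T a b h"
  unfolding lower_darboux_def Sup_ereal_mult_left'[OF divisions_nonempty[OF assms(1-3)] assms(4)]
  by (intro SUP_cong refl lower_sum_scale assms(4))

lemma upper_darboux_scale:
  assumes "a \<in> T" "b \<in> T" "a \<le> b" "0 \<le> r"
  shows "upper_darboux T a b (\<lambda>t. r * h t) = ereal r * upper_darboux T a b h"
  using lower_darboux_scale[OF assms, of "\<lambda>t. - h t"] by (simp add: upper_darboux_conv_lower)

lemma lower_darboux_scale_neg:
  assumes "a \<in> T" "b \<in> T" "a \<le> b" "r \<le> 0"
  shows "lower_darboux T a b (\<lambda>t. r * h t) = ereal r * upper_darboux T a b h"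
  using lower_darboux_scale[OF assms(1-3), of "- r" "\<lambda>t. - h t"] assms(4)
  by (simp add: upper_darboux_conv_lower flip: uminus_ereal.simps)

lemma upper_darboux_scale_neg:
  assumes "a \<in> T" "b \<in> T" "a \<le> b" "r \<le> 0"
  shows "upper_darboux T a b (\<lambda>t. r * h t) = ereal r * lower_darboux T a b h"
  using lower_darboux_scale[OF assms(1-3), of "- r" h] assms(4)
  by (simp add: upper_darboux_conv_lower flip: uminus_ereal.simps)

section \<open>Interval-valued integrals\<close>

lemma lower_Interval [simp]: "l \<le> u \<Longrightarrow> lower (Interval (l, u)) = l"
  by (simp add: lower.rep_eq Interval_inverse)

lemma upper_Interval [simp]: "l \<le> u \<Longrightarrow> upper (Interval (l, u)) = u"
  by (simp add: upper.rep_eq Interval_inverse)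

lemma scale_interval_bounds:
  "lower (scale_interval r X) = (if 0 \<le> r then r * lower X else r * upper X)"
  "upper (scale_interval r X) = (if 0 \<le> r then r * upper X else r * lower X)"
  by (auto simp: scale_interval_def mult_left_mono mult_left_mono_neg)

text \<open>Only because the two Darboux integrals are correctly ordered are they really the endpoints of
  the interval formed from them.\<close>

lemma ID_integrableE:
  assumes "ID_integrable T a b f"
  obtains l u where "lower_darboux T a b (\<lambda>t. lower (f t)) = ereal l"
    and "upper_darboux T a b (\<lambda>t. upper (f t)) = ereal u"
    and "lower (ID_integral T a b f) = l" and "upper (ID_integral T a b f) = u"
proof -
  obtain l u where lu: "lower_darboux T a b (\<lambda>t. lower (f t)) = ereal l"
    "upper_darboux T a b (\<lambda>t. upper (f t)) = ereal u"
    using assms by (auto simp: ID_integrable_def)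
  then have "l \<le> u"
    using lower_darboux_le_upper_darboux[of "\<lambda>t. lower (f t)" "\<lambda>t. upper (f t)" T a b] by simp
  then show ?thesis using that[OF lu] lu by (simp add: ID_integral_def)
qed

lemma ID_integralI:
  assumes "lower_darboux T a b (\<lambda>t. lower (f t)) = ereal l"
    and "upper_darboux T a b (\<lambda>t. upper (f t)) = ereal u"
  shows "ID_integrable T a b f" "lower (ID_integral T a b f) = l" "upper (ID_integral T a b f) = u"
proof -
  show f: "ID_integrable T a b f" using assms by (simp add: ID_integrable_def)
  obtain l' u' where "lower_darboux T a b (\<lambda>t. lower (f t)) = ereal l'"
    "upper_darboux T a b (\<lambda>t. upper (f t)) = ereal u'"
    "lower (ID_integral T a b f) = l'" "upper (ID_integral T a b f) = u'"
    using f by (rule ID_integrableE)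
  then show "lower (ID_integral T a b f) = l" "upper (ID_integral T a b f) = u"
    using assms by auto
qed

lemma ID_integral_scale:
  assumes "a \<in> T" "b \<in> T" "a \<le> b" "ID_integrable T a b f"
  shows "ID_integrable T a b (\<lambda>t. scale_interval r (f t))"
    and "ID_integral T a b (\<lambda>t. scale_interval r (f t)) = scale_interval r (ID_integral T a b f)"
proof -
  obtain l u where lu: "lower_darboux T a b (\<lambda>t. lower (f t)) = ereal l"
    "upper_darboux T a b (\<lambda>t. upper (f t)) = ereal u"
    "lower (ID_integral T a b f) = l" "upper (ID_integral T a b f) = u"
    using assms(4) by (rule ID_integrableE)
  have "lower_darboux T a b (\<lambda>t. lower (scale_interval r (f t))) = ereal (if 0 \<le> r then r * l else r * u)"
    using lu lower_darboux_scale[OF assms(1-3), of r] lower_darboux_scale_neg[OF assms(1-3), of r]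
    by (simp add: scale_interval_bounds)
  moreover have "upper_darboux T a b (\<lambda>t. upper (scale_interval r (f t))) = ereal (if 0 \<le> r then r * u else r * l)"
    using lu upper_darboux_scale[OF assms(1-3), of r] upper_darboux_scale_neg[OF assms(1-3), of r]
    by (simp add: scale_interval_bounds)
  ultimately have *: "ID_integrable T a b (\<lambda>t. scale_interval r (f t))"
    "lower (ID_integral T a b (\<lambda>t. scale_interval r (f t))) = (if 0 \<le> r then r * l else r * u)"
    "upper (ID_integral T a b (\<lambda>t. scale_interval r (f t))) = (if 0 \<le> r then r * u else r * l)"
    by (rule ID_integralI)+
  show "ID_integrable T a b (\<lambda>t. scale_interval r (f t))" by (fact *(1))
  show "ID_integral T a b (\<lambda>t. scale_interval r (f t)) = scale_interval r (ID_integral T a b f)"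
    by (rule interval_eqI) (simp_all only: *(2,3) scale_interval_bounds lu)
qed

text \<open>The chain \<open>l + l' \<le> L \<le> U \<le> u + u'\<close>, with \<open>L\<close> and \<open>U\<close> the Darboux integrals belonging to
  the sum, gives integrability and the inclusion at once.\<close>

lemma ID_integral_add_subset:
  assumes "ID_integrable T a b f" "ID_integrable T a b g"
  shows "ID_integrable T a b (\<lambda>t. f t + g t)"
    and "set_of (ID_integral T a b (\<lambda>t. f t + g t))
           \<subseteq> set_of (ID_integral T a b f + ID_integral T a b g)"
proof -
  obtain l u where f: "lower_darboux T a b (\<lambda>t. lower (f t)) = ereal l"
    "upper_darboux T a b (\<lambda>t. upper (f t)) = ereal u"
    "lower (ID_integral T a b f) = l" "upper (ID_integral T a b f) = u"
    using assms(1) by (rule ID_integrableE)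
  obtain l' u' where g: "lower_darboux T a b (\<lambda>t. lower (g t)) = ereal l'"
    "upper_darboux T a b (\<lambda>t. upper (g t)) = ereal u'"
    "lower (ID_integral T a b g) = l'" "upper (ID_integral T a b g) = u'"
    using assms(2) by (rule ID_integrableE)
  let ?L = "lower_darboux T a b (\<lambda>t. lower (f t + g t))"
  let ?U = "upper_darboux T a b (\<lambda>t. upper (f t + g t))"
  have "ereal (l + l') \<le> ?L"
    using lower_darboux_superadditive[of T a b "\<lambda>t. lower (f t)" "\<lambda>t. lower (g t)"] f g by simp
  moreover have "?U \<le> ereal (u + u')"
    using upper_darboux_subadditive[of T a b "\<lambda>t. upper (f t)" "\<lambda>t. upper (g t)"] f g by simp
  moreover have "?L \<le> ?U" by (rule lower_darboux_le_upper_darboux) (rule lower_le_upper)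
  ultimately obtain p q where pq: "?L = ereal p" "?U = ereal q" "l + l' \<le> p" "q \<le> u + u'"
    by (cases ?L; cases ?U) auto
  show "ID_integrable T a b (\<lambda>t. f t + g t)" using pq(1,2) by (rule ID_integralI)
  show "set_of (ID_integral T a b (\<lambda>t. f t + g t))
          \<subseteq> set_of (ID_integral T a b f + ID_integral T a b g)"
    using pq f g by (auto simp: set_of_eq ID_integralI(2,3)[OF pq(1,2)])
qed

lemma ID_integral_split:
  assumes "ID_integrable T a b f" "c \<in> ts_Icc T a b"
  shows "ID_integrable T a c f" "ID_integrable T c b f"
    and "ID_integral T a c f + ID_integral T c b f = ID_integral T a b f"
proof -
  have fin: "\<bar>lower_darboux T a b (\<lambda>t. lower (f t))\<bar> \<noteq> \<infinity>" "\<bar>upper_darboux T a b (\<lambda>t. upper (f t))\<bar> \<noteq> \<infinity>"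
    using assms(1) by (simp_all add: ID_integrable_def)
  note low = lower_darboux_split[OF assms(2) fin(1)] and upp = upper_darboux_split[OF assms(2) fin(2)]
  show ac: "ID_integrable T a c f" and cb: "ID_integrable T c b f"
    using low(1,2) upp(1,2) by (simp_all add: ID_integrable_def)
  show "ID_integral T a c f + ID_integral T c b f = ID_integral T a b f"
    by (rule interval_eqI; rule ID_integrableE[OF assms(1)]; rule ID_integrableE[OF ac];
        rule ID_integrableE[OF cb]) (use low(3) upp(3) in simp_all)
qed

lemma ID_integral_mono:
  assumes "ID_integrable T a b f" "ID_integrable T a b g"
    and "\<And>t. t \<in> ts_Icc T a b \<Longrightarrow> set_of (f t) \<subseteq> set_of (g t)"
  shows "set_of (ID_integral T a b f) \<subseteq> set_of (ID_integral T a b g)"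
proof -
  have "lower (g t) \<le> lower (f t)" "upper (f t) \<le> upper (g t)" if "t \<in> ts_Icc T a b" for t
    using assms(3)[OF that] by (auto simp: set_of_eq)
  then have "lower_darboux T a b (\<lambda>t. lower (g t)) \<le> lower_darboux T a b (\<lambda>t. lower (f t))"
    "upper_darboux T a b (\<lambda>t. upper (f t)) \<le> upper_darboux T a b (\<lambda>t. upper (g t))"
    by (auto intro: lower_darboux_mono upper_darboux_mono)
  then have "lower (ID_integral T a b g) \<le> lower (ID_integral T a b f)"
    "upper (ID_integral T a b f) \<le> upper (ID_integral T a b g)"
    by (metis ID_integrableE assms(1,2) ereal_less_eq(3))+
  then show ?thesis by (auto simp: set_of_eq)
qed

theorem theorem2:
  fixes T :: "real set" and a b r :: real and f g :: "real \<Rightarrow> real interval"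
  assumes "time_scale T" and "a \<in> T" and "b \<in> T" and "a < b"
    and "ID_integrable T a b f" and "ID_integrable T a b g"
  shows
    "(ID_integrable T a b (\<lambda>t. scale_interval r (f t)) \<and>
      ID_integral T a b (\<lambda>t. scale_interval r (f t)) = scale_interval r (ID_integral T a b f)) \<and>
     (ID_integrable T a b (\<lambda>t. f t + g t) \<and>
      set_of (ID_integral T a b (\<lambda>t. f t + g t))
        \<subseteq> set_of (ID_integral T a b f + ID_integral T a b g)) \<and>
     (\<forall>c \<in> ts_Icc T a b. a < c \<and> c < b \<longrightarrow>
        ID_integrable T a c f \<and> ID_integrable T c b f \<and>
        ID_integral T a c f + ID_integral T c b f = ID_integral T a b f) \<and>
     ((\<forall>t \<in> ts_Icc T a b. set_of (f t) \<subseteq> set_of (g t)) \<longrightarrow>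
        set_of (ID_integral T a b f) \<subseteq> set_of (ID_integral T a b g))"
proof (intro conjI ballI impI)
  note ab = assms(2,3) less_imp_le[OF assms(4)]
  show "ID_integrable T a b (\<lambda>t. scale_interval r (f t))"
    "ID_integral T a b (\<lambda>t. scale_interval r (f t)) = scale_interval r (ID_integral T a b f)"
    using ab assms(5) by (rule ID_integral_scale)+
  show "ID_integrable T a b (\<lambda>t. f t + g t)"
    "set_of (ID_integral T a b (\<lambda>t. f t + g t))
       \<subseteq> set_of (ID_integral T a b f + ID_integral T a b g)"
    using assms(5,6) by (rule ID_integral_add_subset)+
  fix c assume c: "c \<in> ts_Icc T a b"
  show "ID_integrable T a c f" "ID_integrable T c b f"
    "ID_integral T a c f + ID_integral T c b f = ID_integral T a b f"
    using assms(5) c by (rule ID_integral_split)+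
next
  assume "\<forall>t \<in> ts_Icc T a b. set_of (f t) \<subseteq> set_of (g t)"
  then show "set_of (ID_integral T a b f) \<subseteq> set_of (ID_integral T a b g)"
    using assms(5,6) by (blast intro: ID_integral_mono[THEN subsetD])
qed

end
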